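(* Let $G$ be a non-trivial connected graph. Then the following statements are equivalent: (1) $G$ is a tree of diameter at most four, or $G$ is (isomorphic to) a connected subgraph of the complete bipartite graph $K_{2,n}$ for some positive integer $n$. (2) $G$ is a $\gamma\beta$-perfect graph. (3) $G$ is not (isomorphic to) $C_5$, and neither $C_3$ nor $P_6$ is (isomorphic to) a subgraph of $G$.
   Context: All graphs are finite, simple and undirected; $G=(V_G,E_G)$. A graph is non-trivial if it has at least two vertices. "Subgraph" means a not necessarily induced subgraph. $C_k$ denotes the cycle on $k$ vertices, $P_k$ the path on $k$ vertices, and $K_{2,n}$ the complete bipartite graph with parts of sizes $2$ and $n$. A subset $D\subseteq V_G$ is a dominating set of $G$ if each vertex of $V_G-D$ has a neighbor in $D$; the domination number $\gamma(G)$ is the minimum cardinality of a dominating set of $G$. A subset $C\subseteq V_G$ is a vertex cover of $G$ if each edge of $G$ has an end-vertex in $C$; the covering number $\beta(G)$ is the minimum cardinality of a vertex cover of $G$. A connected non-trivial graph $G$ is $\gamma\beta$-perfect if $\gamma(H)=\beta(H)$ for every non-trivial induced connected subgraph $H$ of $G$. *)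

theory Defs
  imports "Graph_Theory.Graph_Theory"
begin

text \<open>
  A finite simple undirected graph is a pair graph: a finite vertex set together with a
  symmetric, irreflexive set of ordered pairs of vertices.  The coercion \<open>with_proj\<close> views a
  pair graph as a digraph, which is where subgraphs, connectedness and isomorphisms are defined.
\<close>

definition nontrivial :: "'a pair_pre_digraph \<Rightarrow> bool" where
  "nontrivial G \<longleftrightarrow> 2 \<le> card (pverts G)"

definition dominating_set :: "'a pair_pre_digraph \<Rightarrow> 'a set \<Rightarrow> bool" where
  "dominating_set G D \<longleftrightarrow>
     D \<subseteq> pverts G \<and> (\<forall>v \<in> pverts G - D. \<exists>u \<in> D. (v, u) \<in> parcs G)"

definition domination_number :: "'a pair_pre_digraph \<Rightarrow> nat" where
  "domination_number G = Min (card ` {D. dominating_set G D})"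

definition vertex_cover :: "'a pair_pre_digraph \<Rightarrow> 'a set \<Rightarrow> bool" where
  "vertex_cover G C \<longleftrightarrow> C \<subseteq> pverts G \<and> (\<forall>(u, v) \<in> parcs G. u \<in> C \<or> v \<in> C)"

definition covering_number :: "'a pair_pre_digraph \<Rightarrow> nat" where
  "covering_number G = Min (card ` {C. vertex_cover G C})"

definition gamma_beta_perfect :: "'a pair_pre_digraph \<Rightarrow> bool" where
  "gamma_beta_perfect G \<longleftrightarrow>
     pair_graph G \<and> Digraph_Component.connected (with_proj G) \<and> nontrivial G \<and>
     (\<forall>H :: 'a pair_pre_digraph.
        induced_subgraph (with_proj H) (with_proj G) \<and>
        Digraph_Component.connected (with_proj H) \<and> nontrivial H \<longrightarrow>
        domination_number H = covering_number H)"

text \<open>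
  The directed notion of cycle counts going back and forth along one edge as a cycle of length
  two, so the library predicate \<^const>\<open>Digraph_Component.tree\<close> fails for every symmetric digraph
  with an edge.  Undirected cycles are the directed cycles of length at least three.
\<close>

definition undirected_tree :: "'a pair_pre_digraph \<Rightarrow> bool" where
  "undirected_tree G \<longleftrightarrow>
     Digraph_Component.connected (with_proj G) \<and>
     \<not> (\<exists>p. pre_digraph.cycle (with_proj G) p \<and> 3 \<le> length p)"

text \<open>With unit weights, \<^const>\<open>wf_digraph.\<mu>\<close> is the distance between two vertices.\<close>

definition diameter :: "'a pair_pre_digraph \<Rightarrow> ereal" where
  "diameter G =
     (SUP u \<in> pverts G. SUP v \<in> pverts G. wf_digraph.\<mu> (with_proj G) (\<lambda>_. 1) u v)"

text \<open>This is the cycle on \<open>k\<close> vertices only for \<open>k \<ge> 3\<close>.\<close>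

definition cycle_graph :: "nat \<Rightarrow> nat pair_pre_digraph" where
  "cycle_graph k =
     \<lparr> pverts = {..<k},
       parcs = {(i, j). i < k \<and> j < k \<and> (j = Suc i mod k \<or> i = Suc j mod k)} \<rparr>"

definition path_graph :: "nat \<Rightarrow> nat pair_pre_digraph" where
  "path_graph k =
     \<lparr> pverts = {..<k}, parcs = {(i, j). i < k \<and> j < k \<and> (j = Suc i \<or> i = Suc j)} \<rparr>"

definition has_subgraph_iso :: "'a pair_pre_digraph \<Rightarrow> 'b pair_pre_digraph \<Rightarrow> bool" where
  "has_subgraph_iso G F \<longleftrightarrow>
     (\<exists>H :: 'a pair_pre_digraph.
        subgraph (with_proj H) (with_proj G) \<and> digraph_iso (with_proj F) (with_proj H))"

definition iso_connected_subgraph_K2n :: "'a pair_pre_digraph \<Rightarrow> nat \<Rightarrow> bool" where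
  "iso_connected_subgraph_K2n G n \<longleftrightarrow>
     (\<exists>(K :: nat pair_pre_digraph) (H :: nat pair_pre_digraph).
        complete_bipartite_digraph 2 n (with_proj K) \<and>
        subgraph (with_proj H) (with_proj K) \<and>
        Digraph_Component.connected (with_proj H) \<and>
        digraph_iso (with_proj G) (with_proj H))"

end

theory Submission
  imports Defs
begin

text \<open>
  All three conditions are compared with a fourth one, phrased on the edge relation alone: a
  connected graph is \<^emph>\<open>free\<close> if it contains, as a not necessarily induced subgraph, neither a
  triangle, nor a five-cycle, nor a path on six vertices.  This is condition (3), because a
  five-cycle in a connected graph either carries a vertex hanging off it, which gives a path on
  six vertices, or has a chord, which gives a triangle, or is the whole graph
  (\<open>iso_cycle5\<close>).  Unlike (3), freeness is visibly inherited by subgraphs.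

  Freeness has a sharp structural consequence.  Suppose there is a four-cycle.  A vertex two
  steps away from it, or pendant neighbours at two consecutive cycle vertices, would give a
  path on six vertices, so two opposite cycle vertices meet every edge and the graph lives in
  \<open>K\<^bsub>2,n\<^esub>\<close> (\<open>cycle4_bipartite\<close>).  Without a four-cycle there is no cycle at all, as every
  cycle on at least six vertices contains the forbidden path, and paths between any two vertices
  have at most four edges.  Conversely, in a tree of diameter at most four a path on six vertices
  would compete with a walk of at most four edges between the same ends; that walk misses one
  edge of the path, which is then not a bridge (\<open>short_tree_no_path6\<close>).  In a subgraph of
  \<open>K\<^bsub>2,n\<^esub>\<close> odd cycles are impossible and two vertices cover all edges, whereas a path on six
  vertices needs three.

  For perfection, the inequality \<open>\<gamma> \<le> \<beta>\<close> holds in every non-trivial connected graph.  If the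
  graph is free and \<open>\<gamma> = 1\<close>, it is a star, so \<open>\<beta> = 1\<close>.  If \<open>\<gamma> \<ge> 2\<close> and there is a four-cycle,
  then \<open>\<beta> \<le> 2\<close> by the above.  In the remaining case the neighbours of leaves form a vertex cover
  (\<open>support_vertices_cover\<close>), and a dominating set must contain, for each of them, the vertex
  itself or its leaf (\<open>card_support_vertices_le\<close>).  In the other direction, each of the three
  forbidden configurations induces a connected graph with \<open>\<gamma> < \<beta>\<close> on its vertices, whatever
  additional edges are present (\<open>not_perfect_if_induced\<close>).
\<close>

section \<open>Paths and cycles in a relation\<close>

text \<open>
  Both notions describe subgraphs that need not be induced, so further arcs between the listed
  vertices are permitted.  A cycle is meaningful from \<open>k = 3\<close> on: in a symmetric relation a
  single edge, traversed back and forth, satisfies the predicate for \<open>k = 2\<close>.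
\<close>

definition has_path :: "'a rel \<Rightarrow> nat \<Rightarrow> bool" where
  "has_path E k \<longleftrightarrow>
     (\<exists>vs. length vs = k \<and> distinct vs \<and> successively (\<lambda>x y. (x, y) \<in> E) vs)"

definition has_cycle :: "'a rel \<Rightarrow> nat \<Rightarrow> bool" where
  "has_cycle E k \<longleftrightarrow>
     (\<exists>vs. length vs = k \<and> distinct vs \<and> successively (\<lambda>x y. (x, y) \<in> E) vs \<and>
        (last vs, hd vs) \<in> E)"

lemma has_path_mono: "has_path E k \<Longrightarrow> E \<subseteq> F \<Longrightarrow> has_path F k"
  unfolding has_path_def by (blast intro: successively_mono)

lemma has_cycle_mono: "has_cycle E k \<Longrightarrow> E \<subseteq> F \<Longrightarrow> has_cycle F k"
  unfolding has_cycle_def by (blast intro: successively_mono)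

lemma has_path_prefix:
  assumes "distinct vs" "successively (\<lambda>x y. (x, y) \<in> E) vs" "k \<le> length vs"
  shows "has_path E k"
proof -
  have "successively (\<lambda>x y. (x, y) \<in> E) (take k vs)"
    using assms(2) successively_append_iff[of _ "take k vs" "drop k vs"] by simp
  with assms show ?thesis
    unfolding has_path_def by (intro exI[of _ "take k vs"]) auto
qed

lemma has_path6I:
  assumes "distinct [a, b, c, d, e, f]"
    and "(a, b) \<in> E" "(b, c) \<in> E" "(c, d) \<in> E" "(d, e) \<in> E" "(e, f) \<in> E"
  shows "has_path E 6"
  unfolding has_path_def by (rule exI[of _ "[a, b, c, d, e, f]"]) (use assms in simp)

lemma has_path6E:
  assumes "has_path E 6"
  obtains a b c d e f where "distinct [a, b, c, d, e, f]"
    and "(a, b) \<in> E" "(b, c) \<in> E" "(c, d) \<in> E" "(d, e) \<in> E" "(e, f) \<in> E"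
  using assms unfolding has_path_def by (auto simp: length_Suc_conv numeral_eq_Suc)

lemma has_cycle3I:
  assumes "(a, b) \<in> E" "(b, c) \<in> E" "(c, a) \<in> E" "irrefl E"
  shows "has_cycle E 3"
  unfolding has_cycle_def
  by (rule exI[of _ "[a, b, c]"]) (use assms in \<open>auto simp: irrefl_def\<close>)

lemma has_cycle3E:
  assumes "has_cycle E 3"
  obtains a b c where "distinct [a, b, c]" and "(a, b) \<in> E" "(b, c) \<in> E" "(c, a) \<in> E"
  using assms unfolding has_cycle_def by (auto simp: length_Suc_conv numeral_eq_Suc)

lemma has_cycle4I:
  assumes "distinct [a, b, c, d]"
    and "(a, b) \<in> E" "(b, c) \<in> E" "(c, d) \<in> E" "(d, a) \<in> E"
  shows "has_cycle E 4"
  unfolding has_cycle_def by (rule exI[of _ "[a, b, c, d]"]) (use assms in simp)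

lemma has_cycle4E:
  assumes "has_cycle E 4"
  obtains a b c d where "distinct [a, b, c, d]"
    and "(a, b) \<in> E" "(b, c) \<in> E" "(c, d) \<in> E" "(d, a) \<in> E"
  using assms unfolding has_cycle_def by (auto simp: length_Suc_conv numeral_eq_Suc)

lemma has_cycle5I:
  assumes "distinct [a, b, c, d, e]"
    and "(a, b) \<in> E" "(b, c) \<in> E" "(c, d) \<in> E" "(d, e) \<in> E" "(e, a) \<in> E"
  shows "has_cycle E 5"
  unfolding has_cycle_def by (rule exI[of _ "[a, b, c, d, e]"]) (use assms in simp)

lemma has_cycle5E:
  assumes "has_cycle E 5"
  obtains a b c d e where "distinct [a, b, c, d, e]"
    and "(a, b) \<in> E" "(b, c) \<in> E" "(c, d) \<in> E" "(d, e) \<in> E" "(e, a) \<in> E"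
  using assms unfolding has_cycle_def by (auto simp: length_Suc_conv numeral_eq_Suc)


section \<open>Isomorphisms, connectedness and induced subgraphs of pair graphs\<close>

text \<open>
  An isomorphism of digraphs carries a vertex map and an independent arc map.  When both ends are
  relations, the projections force the arc map to be the one induced by the vertex map.
\<close>
lemma digraph_iso_pair_iff:
  assumes "pair_wf_digraph F"
  shows "digraph_iso (with_proj F) (with_proj H) \<longleftrightarrow>
    (\<exists>f. inj_on f (pverts F) \<and> pverts H = f ` pverts F \<and> parcs H = map_prod f f ` parcs F)"
    (is "?L \<longleftrightarrow> ?R")
proof
  assume ?L
  then obtain h where h: "pre_digraph.digraph_isomorphism (with_proj F) h"
    and H: "with_proj H = app_iso h (with_proj F)"
    unfolding digraph_iso_def by blast
  have ends: "iso_tail h = fst" "iso_head h = snd"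
    using arg_cong[OF H, of tail] arg_cong[OF H, of head] by simp_all
  have "iso_arcs h e = map_prod (iso_verts h) (iso_verts h) e" if "e \<in> parcs F" for e
    using h that unfolding pre_digraph.digraph_isomorphism_def ends
    by (auto simp: prod_eq_iff)
  then have "parcs H = map_prod (iso_verts h) (iso_verts h) ` parcs F"
    using arg_cong[OF H, of arcs] by (auto simp: image_iff)
  moreover have "inj_on (iso_verts h) (pverts F)"
    using h unfolding pre_digraph.digraph_isomorphism_def by simp
  moreover have "pverts H = iso_verts h ` pverts F"
    using arg_cong[OF H, of verts] by simp
  ultimately show ?R by blast
next
  assume ?R
  then obtain f where f: "inj_on f (pverts F)" "pverts H = f ` pverts F"
    "parcs H = map_prod f f ` parcs F" by blast
  interpret pair_wf_digraph F by fact
  define h where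
    "h = \<lparr>iso_verts = f, iso_arcs = map_prod f f, iso_head = snd, iso_tail = fst\<rparr>"
  have "inj_on (map_prod f f) (parcs F)"
    by (rule inj_on_subset[OF map_prod_inj_on[OF f(1) f(1)]])
      (auto dest: in_arcsD1 in_arcsD2)
  then have "pre_digraph.digraph_isomorphism (with_proj F) h"
    using f(1) wf_digraph unfolding pre_digraph.digraph_isomorphism_def h_def by simp
  moreover have "with_proj H = app_iso h (with_proj F)"
    unfolding app_iso_def h_def by (simp add: f with_proj_def)
  ultimately show ?L unfolding digraph_iso_def by blast
qed

lemma has_subgraph_iso_iff:
  assumes "pair_wf_digraph F" "pair_wf_digraph G"
  shows "has_subgraph_iso G F \<longleftrightarrow>
    (\<exists>f. inj_on f (pverts F) \<and> f ` pverts F \<subseteq> pverts G \<and> map_prod f f ` parcs F \<subseteq> parcs G)"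
    (is "_ \<longleftrightarrow> ?R")
proof
  assume "has_subgraph_iso G F"
  then show ?R
    unfolding has_subgraph_iso_def digraph_iso_pair_iff[OF assms(1)] subgraph_def by fastforce
next
  assume ?R
  then obtain f where f: "inj_on f (pverts F)" "f ` pverts F \<subseteq> pverts G"
    "map_prod f f ` parcs F \<subseteq> parcs G" by blast
  interpret F: pair_wf_digraph F by fact
  let ?H = "\<lparr>pverts = f ` pverts F, parcs = map_prod f f ` parcs F\<rparr>"
  have "pair_wf_digraph ?H"
    by unfold_locales (auto dest: F.in_arcsD1 F.in_arcsD2)
  then have "subgraph (with_proj ?H) (with_proj G)"
    using f assms(2) by (intro subgraphI) (simp_all add: wf_digraph_wp_iff compatibleI_with_proj)
  moreover have "digraph_iso (with_proj F) (with_proj ?H)"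
    using f unfolding digraph_iso_pair_iff[OF assms(1)] by auto
  ultimately show "has_subgraph_iso G F" unfolding has_subgraph_iso_def by blast
qed

lemma wf_path_graph: "pair_wf_digraph (path_graph k)"
  by unfold_locales (auto simp: path_graph_def)

lemma wf_cycle_graph: "pair_wf_digraph (cycle_graph k)"
  by unfold_locales (auto simp: cycle_graph_def)

context pair_graph
begin

lemma sym_parcs: "sym (parcs G)"
  by (auto intro: symI arcs_symmetric)

lemma irrefl_parcs: "irrefl (parcs G)"
  by (auto simp: irrefl_def dest: no_loops')

lemma has_subgraph_iso_path:
  assumes "2 \<le> k"
  shows "has_subgraph_iso G (path_graph k) \<longleftrightarrow> has_path (parcs G) k"
    (is "?L \<longleftrightarrow> ?R")
proof
  assume ?L
  then obtain f where f: "inj_on f {..<k}"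
    "map_prod f f ` parcs (path_graph k) \<subseteq> parcs G"
    unfolding has_subgraph_iso_iff[OF wf_path_graph pair_wf_digraph]
    by (auto simp: path_graph_def)
  have "(f i, f (Suc i)) \<in> parcs G" if "Suc i < k" for i
    using f(2) that by (force simp: path_graph_def)
  then show ?R
    unfolding has_path_def using f(1)
    by (intro exI[of _ "map f [0..<k]"])
      (auto simp: distinct_map successively_conv_nth atLeast0LessThan)
next
  assume ?R
  then obtain vs where vs: "length vs = k" "distinct vs"
    and step: "\<And>i. Suc i < k \<Longrightarrow> (vs ! i, vs ! Suc i) \<in> parcs G"
    unfolding has_path_def successively_conv_nth by blast
  have "vs ! i \<in> pverts G" if "i < k" for i
    using step[of i] step[of "i - 1"] that assms
    by (cases "Suc i < k") (auto dest: in_arcsD1 in_arcsD2)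
  moreover have "inj_on ((!) vs) {..<k}"
    using vs by (intro inj_on_nth) auto
  ultimately show ?L
    unfolding has_subgraph_iso_iff[OF wf_path_graph pair_wf_digraph]
    by (intro exI[of _ "(!) vs"])
      (auto simp: path_graph_def intro: step arcs_symmetric)
qed

lemma has_subgraph_iso_cycle:
  assumes "2 \<le> k"
  shows "has_subgraph_iso G (cycle_graph k) \<longleftrightarrow> has_cycle (parcs G) k"
    (is "?L \<longleftrightarrow> ?R")
proof
  assume ?L
  then obtain f where f: "inj_on f {..<k}"
    "map_prod f f ` parcs (cycle_graph k) \<subseteq> parcs G"
    unfolding has_subgraph_iso_iff[OF wf_cycle_graph pair_wf_digraph]
    by (auto simp: cycle_graph_def)
  have "(f i, f (Suc i mod k)) \<in> parcs G" if "i < k" for i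
    using f(2) that by (force simp: cycle_graph_def)
  from this[of "k - 1"] this have "(f (k - 1), f 0) \<in> parcs G"
    and "\<And>i. Suc i < k \<Longrightarrow> (f i, f (Suc i)) \<in> parcs G"
    using assms by (auto dest: Suc_lessD) (metis Suc_lessD mod_less)
  then show ?R
    unfolding has_cycle_def using f(1) assms
    by (intro exI[of _ "map f [0..<k]"])
      (auto simp: distinct_map successively_conv_nth atLeast0LessThan last_map hd_map)
next
  assume ?R
  then obtain vs where vs: "length vs = k" "distinct vs"
    and step: "\<And>i. Suc i < k \<Longrightarrow> (vs ! i, vs ! Suc i) \<in> parcs G"
    and close: "(last vs, hd vs) \<in> parcs G"
    unfolding has_cycle_def successively_conv_nth by blast
  have next_arc: "(vs ! i, vs ! (Suc i mod k)) \<in> parcs G" if "i < k" for i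
  proof (cases "Suc i < k")
    case False
    then have "i = k - 1" using that by simp
    moreover have "vs \<noteq> []" using vs assms by auto
    ultimately show ?thesis using close vs that by (simp add: last_conv_nth hd_conv_nth)
  qed (use step in simp)
  moreover have "inj_on ((!) vs) {..<k}"
    using vs by (intro inj_on_nth) auto
  ultimately show ?L
    unfolding has_subgraph_iso_iff[OF wf_cycle_graph pair_wf_digraph]
    by (intro exI[of _ "(!) vs"])
      (auto simp: cycle_graph_def dest: in_arcsD1 intro: arcs_symmetric)
qed

lemma connected_iff:
  "Digraph_Component.connected (with_proj G) \<longleftrightarrow>
     pverts G \<noteq> {} \<and> (\<forall>u \<in> pverts G. \<forall>v \<in> pverts G. (u, v) \<in> (parcs G)\<^sup>*)"
proof -
  have "parcs (mk_symmetric (with_proj G)) = parcs G"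
    using adj_mk_symmetric_eq pair_sym_arcs by simp
  then have "u \<rightarrow>\<^sup>*\<^bsub>mk_symmetric (with_proj G)\<^esub> v \<longleftrightarrow> (u, v) \<in> (parcs G)\<^sup>*"
    if "u \<in> pverts G" "v \<in> pverts G" for u v
    using that unfolding reachable_def
    by (auto intro: rtrancl_on_rtranclI rtrancl_consistent_rtrancl_on in_arcsD2)
  then show ?thesis
    unfolding connected_def strongly_connected_def by simp
qed

lemma connected_from_root:
  assumes "r \<in> pverts G" "\<And>v. v \<in> pverts G \<Longrightarrow> (r, v) \<in> (parcs G)\<^sup>*"
  shows "Digraph_Component.connected (with_proj G)"
proof -
  have "sym ((parcs G)\<^sup>*)" by (rule sym_rtrancl[OF sym_parcs])
  then show ?thesis
    unfolding connected_iff using assms(1) assms(2) by (blast intro: rtrancl_trans dest: symD)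
qed

lemma connected_closed:
  assumes "Digraph_Component.connected (with_proj G)" "u \<in> U" "u \<in> pverts G"
    and closed: "\<And>x y. x \<in> U \<Longrightarrow> (x, y) \<in> parcs G \<Longrightarrow> y \<in> U"
  shows "pverts G \<subseteq> U"
proof
  fix v assume "v \<in> pverts G"
  then have "(u, v) \<in> (parcs G)\<^sup>*" using assms connected_iff by blast
  then show "v \<in> U" by induction (auto intro: assms(2) closed)
qed

lemma induced_pair_graph:
  assumes "induced_subgraph (with_proj H) (with_proj G)"
  shows "pair_graph H" "pverts H \<subseteq> pverts G" "parcs H = parcs G \<inter> pverts H \<times> pverts H"
proof -
  show V: "pverts H \<subseteq> pverts G" and E: "parcs H = parcs G \<inter> pverts H \<times> pverts H"
    using assms unfolding induced_subgraph_def subgraph_def by auto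
  show "pair_graph H"
    by unfold_locales
      (auto simp: E symmetric_def intro: symI arcs_symmetric finite_subset[OF V]
        pair_finite_verts pair_finite_arcs dest: no_loops')
qed

end


section \<open>Acyclicity and diameter\<close>

text \<open>Revisiting a vertex while walking allows cutting the path back to that vertex.\<close>
lemma rtrancl_imp_path:
  assumes "(a, b) \<in> R\<^sup>*"
  obtains vs where "distinct vs" "successively (\<lambda>x y. (x, y) \<in> R) vs" "vs \<noteq> []"
    "hd vs = a" "last vs = b"
  using assms
proof (induction arbitrary: thesis rule: rtrancl_induct)
  case base
  show ?case by (rule base[of "[a]"]) auto
next
  case (step y z)
  obtain vs where vs: "distinct vs" "successively (\<lambda>x y. (x, y) \<in> R) vs" "vs \<noteq> []"
    "hd vs = a" "last vs = y" by (rule step.IH)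
  show ?case
  proof (cases "z \<in> set vs")
    case True
    then obtain xs ys where "vs = xs @ z # ys" by (meson split_list)
    with vs show ?thesis
      by (intro step.prems[of "xs @ [z]"])
        (auto simp: successively_append_iff hd_append split: if_splits)
  next
    case False
    with vs step.hyps show ?thesis
      by (intro step.prems[of "vs @ [z]"]) (auto simp: successively_append_iff)
  qed
qed

text \<open>
  A detour around an edge can be taken to be a path; it has at least three vertices as it avoids
  the edge itself, and the edge closes it to a cycle.
\<close>
lemma non_bridge_imp_cycle:
  assumes "(a, b) \<in> R" "a \<noteq> b" "sym R" "(a, b) \<in> (R - {(a, b), (b, a)})\<^sup>*"
  obtains k where "3 \<le> k" "has_cycle R k"
proof -
  obtain vs where vs: "distinct vs" "vs \<noteq> []" "hd vs = a" "last vs = b"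
    and step: "successively (\<lambda>x y. (x, y) \<in> R - {(a, b), (b, a)}) vs"
    by (rule rtrancl_imp_path[OF assms(4)])
  have "\<not> length vs < 3"
  proof
    assume "length vs < 3"
    then consider x where "vs = [x]" | x y where "vs = [x, y]"
      using vs(2) by (cases vs; cases "tl vs"; auto)
    then show False using vs step assms(2) by cases auto
  qed
  moreover have "has_cycle R (length vs)"
    unfolding has_cycle_def using vs step assms(1,3)
    by (intro exI[of _ vs]) (auto elim: successively_mono dest: symD)
  ultimately show ?thesis using that[of "length vs"] by simp
qed

context pair_graph
begin

lemma awalk_imp_successively:
  assumes "awalk u p v"
  shows "successively (\<lambda>x y. (x, y) \<in> parcs G) (pawalk_verts u p)"
    and "hd (pawalk_verts u p) = u" "last (pawalk_verts u p) = v"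
  using assms
proof (induction p arbitrary: u)
  case (Cons e p)
  {
    case 1 with Cons show ?case by (cases e) (auto simp: awalk_Cons_iff successively_Cons)
  next
    case 2 with Cons show ?case by (auto simp: awalk_Cons_iff)
  next
    case 3 with Cons show ?case by (auto simp: awalk_Cons_iff)
  }
qed (auto simp: awalk_Nil_iff)

lemma successively_imp_awalk:
  assumes "successively (\<lambda>x y. (x, y) \<in> parcs G) vs" "vs \<noteq> []" "hd vs \<in> pverts G"
  shows "awalk (hd vs) (zip vs (tl vs)) (last vs)"
    and "pawalk_verts (hd vs) (zip vs (tl vs)) = vs"
proof -
  have "awalk (hd vs) (zip vs (tl vs)) (last vs) \<and> pawalk_verts (hd vs) (zip vs (tl vs)) = vs"
    using assms
  proof (induction vs rule: induct_list012)
    case (3 x y vs)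
    then show ?case by (auto simp: awalk_Cons_iff dest: in_arcsD2)
  qed (auto simp: awalk_Nil_iff)
  then show "awalk (hd vs) (zip vs (tl vs)) (last vs)"
    and "pawalk_verts (hd vs) (zip vs (tl vs)) = vs" by simp_all
qed

lemma length_pawalk_verts: "length (pawalk_verts u p) = Suc (length p)"
  by (induction p arbitrary: u) auto

lemma undirected_tree_iff:
  "undirected_tree G \<longleftrightarrow>
     Digraph_Component.connected (with_proj G) \<and> (\<forall>k\<ge>3. \<not> has_cycle (parcs G) k)"
proof -
  have "\<exists>k\<ge>3. has_cycle (parcs G) k" if cyc: "cycle p" and len: "3 \<le> length p" for p
  proof -
    from cyc obtain u where u: "awalk u p u" "distinct (tl (pawalk_verts u p))"
      unfolding cycle_def by auto
    obtain e q where p: "p = e # q" using len by (cases p) auto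
    then have q: "awalk (snd e) q u" "distinct (pawalk_verts (snd e) q)" "(u, snd e) \<in> parcs G"
      using u by (auto simp: awalk_Cons_iff)
    have "has_cycle (parcs G) (length p)"
      unfolding has_cycle_def using q awalk_imp_successively[OF q(1)]
      by (intro exI[of _ "pawalk_verts (snd e) q"]) (auto simp: p length_pawalk_verts)
    then show ?thesis using len by blast
  qed
  moreover have "\<exists>p. cycle p \<and> 3 \<le> length p" if cyc: "has_cycle (parcs G) k" and len: "3 \<le> k" for k
  proof -
    from cyc obtain vs where vs: "length vs = k" "distinct vs"
      "successively (\<lambda>x y. (x, y) \<in> parcs G) vs" "(last vs, hd vs) \<in> parcs G"
      unfolding has_cycle_def by blast
    have ne: "vs \<noteq> []" using vs(1) len by auto
    note walk = successively_imp_awalk[OF vs(3) ne in_arcsD2[OF vs(4)]]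
    have "awalk (last vs) ((last vs, hd vs) # zip vs (tl vs)) (last vs)"
      using walk(1) vs(4) in_arcsD1[OF vs(4)] by (simp add: awalk_Cons_iff)
    then have "cycle ((last vs, hd vs) # zip vs (tl vs))"
      unfolding cycle_def using walk(2) vs(2) by (intro exI[of _ "last vs"]) simp
    then show ?thesis using len vs(1) by (intro exI conjI) auto
  qed
  ultimately show ?thesis unfolding undirected_tree_def by blast
qed

text \<open>Distances are infima over walks; in a finite connected graph they are attained.\<close>
lemma diameter_le_iff:
  assumes "Digraph_Component.connected (with_proj G)"
  shows "diameter G \<le> ereal (real d) \<longleftrightarrow>
    (\<forall>u \<in> pverts G. \<forall>v \<in> pverts G. \<exists>p. awalk u p v \<and> length p \<le> d)"
proof -
  have cost: "awalk_cost (\<lambda>_. 1) p = real (length p)" for p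
    unfolding awalk_cost_def by (simp add: sum_list_triv)
  have "\<mu> (\<lambda>_. 1) u v \<le> ereal (real d) \<longleftrightarrow> (\<exists>p. awalk u p v \<and> length p \<le> d)" (is "?L \<longleftrightarrow> ?R")
    if uv: "u \<in> pverts G" "v \<in> pverts G" for u v
  proof
    assume ?L
    have "u \<rightarrow>\<^sup>*\<^bsub>with_proj G\<^esub> v"
      using assms uv unfolding connected_iff reachable_def
      by (auto intro: rtrancl_consistent_rtrancl_on in_arcsD2)
    then obtain p where "apath u p v" "\<mu> (\<lambda>_. 1) u v = awalk_cost (\<lambda>_. 1) p"
      using min_cost_awalk[of u v "\<lambda>_. 1"] by auto
    with \<open>?L\<close> cost show ?R by (auto dest: awalkI_apath)
  next
    assume ?R
    then obtain p where p: "awalk u p v" "length p \<le> d" by blast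
    from min_cost_le_walk_cost[OF p(1), of "\<lambda>_. 1"] p(2) show ?L
      by (simp add: cost) (metis ereal_less_eq(3) of_nat_le_iff order_trans)
  qed
  then show ?thesis unfolding diameter_def by (simp add: SUP_le_iff)
qed

text \<open>
  The five edges of the path cannot all be among the at most four edges of a walk joining its
  ends.  Going around through the walk and the rest of the path, the two ends of a missing edge
  \<open>xy\<close> remain connected after deleting \<open>xy\<close>, so \<open>xy\<close> is not a bridge.
\<close>
lemma short_tree_no_path6:
  assumes acyclic: "\<And>k. 3 \<le> k \<Longrightarrow> \<not> has_cycle (parcs G) k"
    and short: "\<And>u v. u \<in> pverts G \<Longrightarrow> v \<in> pverts G \<Longrightarrow> \<exists>p. awalk u p v \<and> length p \<le> 4"
  shows "\<not> has_path (parcs G) 6"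
proof
  assume "has_path (parcs G) 6"
  then obtain a b c d e f where v: "distinct [a, b, c, d, e, f]"
    and E: "(a, b) \<in> parcs G" "(b, c) \<in> parcs G" "(c, d) \<in> parcs G" "(d, e) \<in> parcs G"
      "(e, f) \<in> parcs G"
    by (rule has_path6E)
  obtain p where p: "awalk a p f" "length p \<le> 4"
    using short[OF in_arcsD1[OF E(1)] in_arcsD2[OF E(5)]] by blast
  let ?edges = "{{a, b}, {b, c}, {c, d}, {d, e}, {e, f}}"
  define W where "W = (\<lambda>(x, y). {x, y}) ` set p"
  have "card W \<le> 4"
    unfolding W_def using p(2) card_length[of p] card_image_le[of "set p" "\<lambda>(x, y). {x, y}"]
    by simp
  moreover have card_edges: "card ?edges = 5" using v by (auto simp: doubleton_eq_iff card_insert_if)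
  moreover have "finite W" unfolding W_def by simp
  ultimately have "\<not> ?edges \<subseteq> W" using card_mono[of W ?edges] by linarith
  then obtain x y where xy: "{x, y} \<in> ?edges" "{x, y} \<notin> W" "(x, y) \<in> parcs G"
    using E by blast
  define R where "R = parcs G - {(x, y), (y, x)}"
  have "sym R" unfolding R_def using sym_parcs by (auto simp: sym_def)
  then have equiv: "equiv UNIV (R\<^sup>*)"
    by (simp add: equiv_def refl_rtrancl sym_rtrancl trans_rtrancl)
  \<comment> \<open>Components after deleting \<open>xy\<close>, so that connection becomes equality.\<close>
  define cls where "cls s = R\<^sup>* `` {s}" for s
  have same: "(s, t) \<in> R\<^sup>* \<longleftrightarrow> cls s = cls t" for s t
    unfolding cls_def using eq_equiv_class_iff[OF equiv] by simp
  have "(u, v) \<in> R\<^sup>*" if "awalk u q v" "set q \<subseteq> set p" for u q v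
    using that
  proof (induction q arbitrary: u)
    case (Cons e q)
    then have e: "e \<in> set p" "e \<in> parcs G" "fst e = u" "(snd e, v) \<in> R\<^sup>*"
      by (auto simp: awalk_Cons_iff)
    have "(u, snd e) \<in> R"
      using e xy(2) unfolding R_def W_def by (force simp: insert_commute)
    with e(4) show ?case by (rule converse_rtrancl_into_rtrancl[rotated -1])
  qed (simp add: awalk_Nil_iff)
  then have af: "cls a = cls f" using p(1) same by blast
  have other: "cls s = cls t" if "(s, t) \<in> parcs G" "{s, t} \<noteq> {x, y}" for s t
  proof -
    have "(s, t) \<in> R" using that unfolding R_def by auto
    then show ?thesis using same by blast
  qed
  note other = other[OF E(1)] other[OF E(2)] other[OF E(3)] other[OF E(4)] other[OF E(5)]
  have dist: "distinct [{a, b}, {b, c}, {c, d}, {d, e}, {e, f}]"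
    by (rule card_distinct) (simp add: card_edges)
  have "{x, y} = {a, b} \<or> {x, y} = {b, c} \<or> {x, y} = {c, d} \<or> {x, y} = {d, e} \<or> {x, y} = {e, f}"
    using xy(1) by simp
  then have "cls x = cls y"
  proof (elim disjE)
    assume xy_eq: "{x, y} = {a, b}"
    have "cls a = cls b"
      using other(2-5) af dist[simplified] xy_eq by metis
    with xy_eq show ?thesis by (auto simp: doubleton_eq_iff)
  next
    assume xy_eq: "{x, y} = {b, c}"
    have "cls b = cls c"
      using other(1,3-5) af dist[simplified] xy_eq by metis
    with xy_eq show ?thesis by (auto simp: doubleton_eq_iff)
  next
    assume xy_eq: "{x, y} = {c, d}"
    have "cls c = cls d"
      using other(1,2,4,5) af dist[simplified] xy_eq by metis
    with xy_eq show ?thesis by (auto simp: doubleton_eq_iff)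
  next
    assume xy_eq: "{x, y} = {d, e}"
    have "cls d = cls e"
      using other(1-3,5) af dist[simplified] xy_eq by metis
    with xy_eq show ?thesis by (auto simp: doubleton_eq_iff)
  next
    assume xy_eq: "{x, y} = {e, f}"
    have "cls e = cls f"
      using other(1-4) af dist[simplified] xy_eq by metis
    with xy_eq show ?thesis by (auto simp: doubleton_eq_iff)
  qed
  then have "(x, y) \<in> R\<^sup>*" using same by blast
  then show False
    using non_bridge_imp_cycle[OF xy(3) no_loops'[OF xy(3)] sym_parcs] acyclic
    unfolding R_def by blast
qed

lemma no_path6_imp_short:
  assumes "Digraph_Component.connected (with_proj G)" "\<not> has_path (parcs G) 6"
    and "u \<in> pverts G" "v \<in> pverts G"
  shows "\<exists>p. awalk u p v \<and> length p \<le> 4"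
proof -
  have "(u, v) \<in> (parcs G)\<^sup>*" using assms connected_iff by blast
  then obtain vs where vs: "distinct vs" "successively (\<lambda>x y. (x, y) \<in> parcs G) vs" "vs \<noteq> []"
    "hd vs = u" "last vs = v" by (rule rtrancl_imp_path)
  then have "\<not> 6 \<le> length vs" using has_path_prefix assms(2) by blast
  then have "length (zip vs (tl vs)) \<le> 4" by simp
  moreover have "awalk u (zip vs (tl vs)) v"
    using successively_imp_awalk(1)[OF vs(2,3)] vs(4,5) assms(3) by simp
  ultimately show ?thesis by blast
qed

lemma no_short_cycle_imp_acyclic:
  assumes "\<not> has_cycle (parcs G) 3" "\<not> has_cycle (parcs G) 4" "\<not> has_cycle (parcs G) 5"
    "\<not> has_path (parcs G) 6" "3 \<le> k"
  shows "\<not> has_cycle (parcs G) k"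
proof
  assume k: "has_cycle (parcs G) k"
  then have "\<not> 6 \<le> k"
    using assms(4) has_path_prefix unfolding has_cycle_def by blast
  with k assms show False
    by (cases "k = 3"; cases "k = 4"; cases "k = 5") auto
qed

end

section \<open>Domination and covering\<close>

context pair_graph
begin

lemma domination_number_le: "dominating_set G D \<Longrightarrow> domination_number G \<le> card D"
  unfolding domination_number_def
  by (rule Min_le) (auto simp: dominating_set_def intro!: finite_imageI
      finite_subset[of _ "Pow (pverts G)"] pair_finite_verts)

lemma covering_number_le: "vertex_cover G C \<Longrightarrow> covering_number G \<le> card C"
  unfolding covering_number_def
  by (rule Min_le) (auto simp: vertex_cover_def intro!: finite_imageI
      finite_subset[of _ "Pow (pverts G)"] pair_finite_verts)

lemma obtain_minimum_dominating_set:
  obtains D where "dominating_set G D" "card D = domination_number G"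
proof -
  have "finite {D. dominating_set G D}"
    by (rule finite_subset[of _ "Pow (pverts G)"])
      (auto simp: dominating_set_def pair_finite_verts)
  moreover have "dominating_set G (pverts G)" unfolding dominating_set_def by auto
  ultimately have "domination_number G \<in> card ` {D. dominating_set G D}"
    unfolding domination_number_def by (intro Min_in) auto
  then show ?thesis using that by auto
qed

lemma obtain_minimum_vertex_cover:
  obtains C where "vertex_cover G C" "card C = covering_number G"
proof -
  have "finite {C. vertex_cover G C}"
    by (rule finite_subset[of _ "Pow (pverts G)"])
      (auto simp: vertex_cover_def pair_finite_verts)
  moreover have "vertex_cover G (pverts G)"
    unfolding vertex_cover_def by (auto dest: in_arcsD1)
  ultimately have "covering_number G \<in> card ` {C. vertex_cover G C}"
    unfolding covering_number_def by (intro Min_in) auto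
  then show ?thesis using that by auto
qed

lemma connected_nontrivial_neighbour:
  assumes "Digraph_Component.connected (with_proj G)" "nontrivial G" "v \<in> pverts G"
  obtains w where "(v, w) \<in> parcs G"
proof (rule ccontr)
  assume "\<not> thesis"
  then have "pverts G \<subseteq> {v}"
    using that by (intro connected_closed[OF assms(1) _ assms(3)]) auto
  then have "card (pverts G) \<le> 1" using card_mono[of "{v}"] by fastforce
  then show False using assms(2) unfolding nontrivial_def by simp
qed

lemma domination_number_le_covering_number:
  assumes "Digraph_Component.connected (with_proj G)" "nontrivial G"
  shows "domination_number G \<le> covering_number G"
proof -
  obtain C where C: "vertex_cover G C" "card C = covering_number G"
    by (rule obtain_minimum_vertex_cover)
  have "\<exists>u\<in>C. (v, u) \<in> parcs G" if v: "v \<in> pverts G - C" for v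
  proof -
    obtain w where "(v, w) \<in> parcs G"
      using connected_nontrivial_neighbour[OF assms] v by blast
    then show ?thesis using C(1) v unfolding vertex_cover_def by blast
  qed
  then have "dominating_set G C" using C(1) unfolding dominating_set_def vertex_cover_def by auto
  then show ?thesis using domination_number_le C(2) by metis
qed

lemma dominating_singleton_covers:
  assumes "\<not> has_cycle (parcs G) 3" "dominating_set G {r}"
  shows "vertex_cover G {r}"
proof -
  have "u = r \<or> v = r" if "(u, v) \<in> parcs G" for u v
  proof (rule ccontr)
    assume "\<not> ?thesis"
    then have "(u, r) \<in> parcs G" "(v, r) \<in> parcs G"
      using that assms(2) unfolding dominating_set_def by (auto dest: in_arcsD1 in_arcsD2)
    then show False
      using that assms(1) has_cycle3I[OF that _ _ irrefl_parcs] arcs_symmetric by blast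
  qed
  then show ?thesis using assms(2) unfolding dominating_set_def vertex_cover_def by blast
qed

text \<open>
  With a four-cycle \<open>abcd\<close>, a vertex at distance two from the cycle starts a path on six vertices
  that runs once around it, so every edge meets the cycle.  If both \<open>{a, c}\<close> and \<open>{b, d}\<close> had
  neighbours off the cycle, the path going the long way between the two attachment points, extended
  by these neighbours, would have six vertices.  Hence one of the two opposite pairs meets every
  edge.
\<close>
lemma cycle4_bipartite:
  assumes conn: "Digraph_Component.connected (with_proj G)"
    and no3: "\<not> has_cycle (parcs G) 3" and no6: "\<not> has_path (parcs G) 6"
    and c4: "has_cycle (parcs G) 4"
  obtains S where "card S = 2" "S \<subset> pverts G"
    "parcs G \<subseteq> S \<times> (pverts G - S) \<union> (pverts G - S) \<times> S"
proof -
  note bipartition = that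
  obtain a b c d where Z: "distinct [a, b, c, d]"
    and E: "(a, b) \<in> parcs G" "(b, c) \<in> parcs G" "(c, d) \<in> parcs G" "(d, a) \<in> parcs G"
    using c4 by (rule has_cycle4E)
  note E' = E[THEN arcs_symmetric]
  let ?Z = "{a, b, c, d}"
  note path = has_path6I[where E = "parcs G"]
  have "?Z \<subseteq> pverts G" using E by (auto dest: in_arcsD1 in_arcsD2)
  have outside: "y \<in> ?Z" if "(z, x) \<in> parcs G" "z \<in> ?Z" "(x, y) \<in> parcs G" "x \<notin> ?Z" for x y z
  proof (rule ccontr)
    assume y: "y \<notin> ?Z"
    have "x \<noteq> y" using that(3) no_loops' by blast
    note xy = arcs_symmetric[OF that(1)] arcs_symmetric[OF that(3)]
    from that(2) consider "z = a" | "z = b" | "z = c" | "z = d" by blast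
    then have "has_path (parcs G) 6"
    proof cases
      case 1
      show ?thesis by (rule path[of y x a b c d]) (use 1 y \<open>x \<noteq> y\<close> that(4) xy Z E in auto)
    next
      case 2
      show ?thesis by (rule path[of y x b c d a]) (use 2 y \<open>x \<noteq> y\<close> that(4) xy Z E in auto)
    next
      case 3
      show ?thesis by (rule path[of y x c d a b]) (use 3 y \<open>x \<noteq> y\<close> that(4) xy Z E in auto)
    next
      case 4
      show ?thesis by (rule path[of y x d a b c]) (use 4 y \<open>x \<noteq> y\<close> that(4) xy Z E in auto)
    qed
    with no6 show False by simp
  qed
  have "pverts G \<subseteq> ?Z \<union> {x. \<exists>z\<in>?Z. (z, x) \<in> parcs G}"
  proof (rule connected_closed[OF conn])
    show "a \<in> pverts G" using E(1) by (rule in_arcsD1)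
    show "y \<in> ?Z \<union> {x. \<exists>z\<in>?Z. (z, x) \<in> parcs G}"
      if "x \<in> ?Z \<union> {x. \<exists>z\<in>?Z. (z, x) \<in> parcs G}" "(x, y) \<in> parcs G" for x y
      using that outside by blast
  qed simp
  then have no_outer: "x \<in> ?Z \<or> y \<in> ?Z" if "(x, y) \<in> parcs G" for x y
    using that outside in_arcsD1 by blast
  have one_side: False
    if pq: "p \<in> {a, c}" "q \<in> {b, d}"
      and out: "(p, x) \<in> parcs G" "(q, y) \<in> parcs G" "x \<notin> ?Z" "y \<notin> ?Z"
    for p q x y
  proof -
    have "(p, q) \<in> parcs G" using pq E E' by auto
    then have "x \<noteq> y"
      using out(1,2) no3 has_cycle3I[OF _ _ _ irrefl_parcs] arcs_symmetric by blast
    note facts = out Z E E' arcs_symmetric[OF out(1)] \<open>x \<noteq> y\<close>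
    consider "p = a" "q = b" | "p = a" "q = d" | "p = c" "q = b" | "p = c" "q = d"
      using pq by blast
    then have "has_path (parcs G) 6"
    proof cases
      case 1
      show ?thesis by (rule path[of x a d c b y]) (use 1 facts in auto)
    next
      case 2
      show ?thesis by (rule path[of x a b c d y]) (use 2 facts in auto)
    next
      case 3
      show ?thesis by (rule path[of x c d a b y]) (use 3 facts in auto)
    next
      case 4
      show ?thesis by (rule path[of x c b a d y]) (use 4 facts in auto)
    qed
    with no6 show False by simp
  qed
  have chords: "(a, c) \<notin> parcs G" "(c, a) \<notin> parcs G" "(b, d) \<notin> parcs G" "(d, b) \<notin> parcs G"
    using E E' no3 has_cycle3I[OF _ _ _ irrefl_parcs] by blast+
  have bipartite: thesis
    if ST: "S \<union> T = ?Z" "S \<inter> T = {}" "T \<noteq> {}" "card S = 2"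
      and indep: "\<And>x y. (x, y) \<in> parcs G \<Longrightarrow> \<not> (x \<in> S \<and> y \<in> S) \<and> \<not> (x \<in> T \<and> y \<in> T)"
      and inner: "\<And>x y. x \<in> T \<Longrightarrow> (x, y) \<in> parcs G \<Longrightarrow> y \<in> ?Z"
    for S T
  proof (rule bipartition)
    show "card S = 2" by (rule ST(4))
    show "S \<subset> pverts G" using ST(1-3) \<open>?Z \<subseteq> pverts G\<close> by blast
    have "x \<in> S \<longleftrightarrow> y \<notin> S" if xy: "(x, y) \<in> parcs G" for x y
    proof -
      have "x \<in> S \<or> y \<in> S"
        using no_outer[OF xy] ST(1) indep[OF xy] inner[OF _ xy] inner[OF _ arcs_symmetric[OF xy]]
        by blast
      with indep[OF xy] show ?thesis by blast
    qed
    then show "parcs G \<subseteq> S \<times> (pverts G - S) \<union> (pverts G - S) \<times> S"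
      by (auto dest: in_arcsD1 in_arcsD2)
  qed
  have indep: "\<not> (x \<in> {a, c} \<and> y \<in> {a, c}) \<and> \<not> (x \<in> {b, d} \<and> y \<in> {b, d})"
    if "(x, y) \<in> parcs G" for x y
    using that chords no_loops' by blast
  show ?thesis
  proof (cases "\<exists>q\<in>{b, d}. \<exists>y. (q, y) \<in> parcs G \<and> y \<notin> ?Z")
    case True
    then have inner: "y \<in> ?Z" if "p \<in> {a, c}" "(p, y) \<in> parcs G" for p y
      using that one_side by blast
    show ?thesis by (rule bipartite[of "{b, d}" "{a, c}"]) (use indep inner Z in auto)
  next
    case False
    then have inner: "y \<in> ?Z" if "p \<in> {b, d}" "(p, y) \<in> parcs G" for p y
      using that by blast
    show ?thesis by (rule bipartite[of "{a, c}" "{b, d}"]) (use indep inner Z in auto)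
  qed
qed

text \<open>The neighbours of leaves.\<close>
definition support_vertices :: "'a set" where
  "support_vertices = {s. \<exists>l. (s, l) \<in> parcs G \<and> (\<forall>w. (l, w) \<in> parcs G \<longrightarrow> w = s)}"

text \<open>
  If neither end of an edge \<open>xy\<close> is next to a leaf, then the edge extends by two vertices beyond
  each end, and in the absence of short cycles the six vertices \<open>x'' x' x y y' y''\<close> are distinct.
\<close>
lemma support_vertices_cover:
  assumes no3: "\<not> has_cycle (parcs G) 3" and no4: "\<not> has_cycle (parcs G) 4"
    and no5: "\<not> has_cycle (parcs G) 5" and no6: "\<not> has_path (parcs G) 6"
  shows "vertex_cover G support_vertices"
proof -
  have "x \<in> support_vertices \<or> y \<in> support_vertices" if xy: "(x, y) \<in> parcs G" for x y
  proof (rule ccontr)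
    assume not_supp: "\<not> ?thesis"
    note yx = arcs_symmetric[OF xy]
    from not_supp xy obtain y' where y': "(y, y') \<in> parcs G" "y' \<noteq> x"
      unfolding support_vertices_def by blast
    from not_supp y' obtain y'' where y'': "(y', y'') \<in> parcs G" "y'' \<noteq> y"
      unfolding support_vertices_def by blast
    from not_supp yx obtain x' where x': "(x, x') \<in> parcs G" "x' \<noteq> y"
      unfolding support_vertices_def by blast
    from not_supp x' obtain x'' where x'': "(x', x'') \<in> parcs G" "x'' \<noteq> x"
      unfolding support_vertices_def by blast
    note E = xy y'(1) y''(1) x'(1) x''(1)
    note E' = E[THEN arcs_symmetric]
    note adj = E[THEN no_loops']
    note c3 = has_cycle3I[OF _ _ _ irrefl_parcs]
    have 3: "x'' \<noteq> y" "x' \<noteq> y'" "x \<noteq> y''"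
      using E E' no3 c3 by blast+
    have "has_cycle (parcs G) 4" if "x'' = y'"
      by (rule has_cycle4I[of x' x y y']) (use that E E' adj 3 x' y' in auto)
    moreover have "has_cycle (parcs G) 4" if "x' = y''"
      by (rule has_cycle4I[of x' x y y']) (use that E E' adj 3 x' y' in auto)
    ultimately have 4: "x'' \<noteq> y'" "x' \<noteq> y''" using no4 by blast+
    have "has_cycle (parcs G) 5" if "x'' = y''"
      by (rule has_cycle5I[of x'' x' x y y']) (use that E E' adj 3 4 x' y' x'' in auto)
    with no5 have 5: "x'' \<noteq> y''" by blast
    have "has_path (parcs G) 6"
      by (rule has_path6I[of x'' x' x y y' y''])
        (use E E' adj 3 4 5 x' y' x'' y'' in auto)
    with no6 show False by blast
  qed
  then show ?thesis
    unfolding vertex_cover_def by (auto simp: support_vertices_def dest: in_arcsD1)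
qed

text \<open>
  A leaf is dominated only by itself or by its unique neighbour, so choosing a leaf at each support
  vertex makes a dominating set meet pairwise disjoint two-element sets.  Disjointness fails only
  for the graph with a single edge, where both vertices are leaves and support vertices; there one
  vertex dominates.
\<close>
lemma card_support_vertices_le:
  assumes conn: "Digraph_Component.connected (with_proj G)"
    and D: "dominating_set G D" and no1: "\<And>r. \<not> dominating_set G {r}"
  shows "card support_vertices \<le> card D"
proof -
  have "\<forall>s \<in> support_vertices. \<exists>l. (s, l) \<in> parcs G \<and> (\<forall>w. (l, w) \<in> parcs G \<longrightarrow> w = s)"
    unfolding support_vertices_def by blast
  then obtain l where l: "\<And>s. s \<in> support_vertices \<Longrightarrow> (s, l s) \<in> parcs G"
    and leaf: "\<And>s w. s \<in> support_vertices \<Longrightarrow> (l s, w) \<in> parcs G \<Longrightarrow> w = s"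
    by metis
  have no_K2: "s' \<noteq> l s" if s: "s \<in> support_vertices" "s' \<in> support_vertices" for s s'
  proof
    assume eq: "s' = l s"
    have ls': "l s' = s" using leaf[OF s(1)] l[OF s(2)] eq by blast
    have V: "pverts G \<subseteq> {s, s'}"
    proof (rule connected_closed[OF conn, of s])
      show "s \<in> pverts G" using l[OF s(1)] by (rule in_arcsD1)
      show "y \<in> {s, s'}" if "x \<in> {s, s'}" "(x, y) \<in> parcs G" for x y
        using that leaf[OF s(1), of y] leaf[OF s(2), of y] eq ls' by auto
    qed simp
    have "dominating_set G {s}"
      unfolding dominating_set_def
      using V in_arcsD1[OF l[OF s(1)]] l[OF s(1), THEN arcs_symmetric] eq by auto
    with no1 show False by blast
  qed
  define g where "g s = (if s \<in> D then s else l s)" for s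
  have "g ` support_vertices \<subseteq> D"
  proof
    fix d assume "d \<in> g ` support_vertices"
    then obtain s where s: "s \<in> support_vertices" "d = g s" by blast
    have "l s \<in> D" if "s \<notin> D"
    proof (rule ccontr)
      assume "l s \<notin> D"
      then obtain u where "u \<in> D" "(l s, u) \<in> parcs G"
        using D in_arcsD2[OF l[OF s(1)]] unfolding dominating_set_def by blast
      with leaf[OF s(1)] that show False by blast
    qed
    then show "d \<in> D" unfolding s(2) g_def by simp
  qed
  moreover have "inj_on g support_vertices"
  proof (rule inj_onI)
    fix s s' assume s: "s \<in> support_vertices" "s' \<in> support_vertices" and eq: "g s = g s'"
    from no_K2[OF s] no_K2[OF s(2,1)] eq have "s = s' \<or> l s = l s'"
      unfolding g_def by (auto split: if_splits)
    then show "s = s'"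
      using leaf[OF s(1)] arcs_symmetric[OF l[OF s(2)]] by auto
  qed
  moreover have "finite D"
    using D pair_finite_verts unfolding dominating_set_def by (blast intro: finite_subset)
  ultimately show ?thesis using card_inj_on_le by blast
qed

lemma domination_number_eq_covering_number:
  assumes conn: "Digraph_Component.connected (with_proj G)" and nontriv: "nontrivial G"
    and no3: "\<not> has_cycle (parcs G) 3" and no5: "\<not> has_cycle (parcs G) 5"
    and no6: "\<not> has_path (parcs G) 6"
  shows "domination_number G = covering_number G"
proof (rule antisym)
  show "domination_number G \<le> covering_number G"
    using conn nontriv by (rule domination_number_le_covering_number)
  obtain D where D: "dominating_set G D" "card D = domination_number G"
    by (rule obtain_minimum_dominating_set)
  have finD: "finite D"
    using D(1) pair_finite_verts unfolding dominating_set_def by (blast intro: finite_subset)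
  have "D \<noteq> {}"
    using D(1) nontriv unfolding dominating_set_def nontrivial_def by auto
  with finD have D_pos: "1 \<le> card D" by (simp add: Suc_leI card_gt_0_iff)
  show "covering_number G \<le> domination_number G"
  proof (cases "\<exists>r. dominating_set G {r}")
    case True
    then obtain r where "vertex_cover G {r}" using dominating_singleton_covers no3 by blast
    with covering_number_le[of "{r}"] D_pos D(2) show ?thesis by simp
  next
    case no1: False
    then have "card D \<noteq> 1" using D(1) by (auto simp: card_1_singleton_iff)
    with D_pos have D2: "2 \<le> card D" by simp
    show ?thesis
    proof (cases "has_cycle (parcs G) 4")
      case True
      then obtain S where S: "card S = 2" "S \<subset> pverts G"
        "parcs G \<subseteq> S \<times> (pverts G - S) \<union> (pverts G - S) \<times> S"
        using cycle4_bipartite[OF conn no3 no6] by blast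
      then have "vertex_cover G S" unfolding vertex_cover_def by auto
      with covering_number_le[of S] S(1) D2 D(2) show ?thesis by simp
    next
      case False
      then have "vertex_cover G support_vertices"
        using support_vertices_cover no3 no5 no6 by blast
      with covering_number_le[of support_vertices] card_support_vertices_le[OF conn D(1)] no1 D(2)
      show ?thesis by force
    qed
  qed
qed

section \<open>Perfect graphs have no forbidden subgraphs, and conversely\<close>

lemma cover_path6_card:
  assumes "has_path (parcs G) 6" "vertex_cover G C"
  shows "3 \<le> card C"
proof -
  obtain a b c d e f where v: "distinct [a, b, c, d, e, f]"
    and E: "(a, b) \<in> parcs G" "(b, c) \<in> parcs G" "(c, d) \<in> parcs G" "(d, e) \<in> parcs G"
      "(e, f) \<in> parcs G"
    using assms(1) by (rule has_path6E)
  have cover: "u \<in> C \<or> w \<in> C" if "(u, w) \<in> parcs G" for u w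
    using assms(2) that unfolding vertex_cover_def by blast
  obtain x y z where "x \<in> {a, b}" "x \<in> C" "y \<in> {c, d}" "y \<in> C" "z \<in> {e, f}" "z \<in> C"
    using cover[OF E(1)] cover[OF E(3)] cover[OF E(5)] by blast
  then have "{x, y, z} \<subseteq> C" "card {x, y, z} = 3" using v by auto
  moreover have "finite C"
    using assms(2) pair_finite_verts unfolding vertex_cover_def by (blast intro: finite_subset)
  ultimately show ?thesis using card_mono by metis
qed

lemma cover_cycle5_card:
  assumes "has_cycle (parcs G) 5" "vertex_cover G C"
  shows "3 \<le> card C"
proof -
  obtain a b c d e where v: "distinct [a, b, c, d, e]"
    and E: "(a, b) \<in> parcs G" "(b, c) \<in> parcs G" "(c, d) \<in> parcs G" "(d, e) \<in> parcs G"
      "(e, a) \<in> parcs G"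
    using assms(1) by (rule has_cycle5E)
  have cover: "u \<in> C \<or> w \<in> C" if "(u, w) \<in> parcs G" for u w
    using assms(2) that unfolding vertex_cover_def by blast
  have "\<exists>x y z. {x, y, z} \<subseteq> C \<and> distinct [x, y, z]"
  proof (cases "a \<in> C")
    case True
    obtain y z where "y \<in> {b, c}" "y \<in> C" "z \<in> {d, e}" "z \<in> C"
      using cover[OF E(2)] cover[OF E(4)] by blast
    with True v show ?thesis by (intro exI[of _ a] exI[of _ y] exI[of _ z]) auto
  next
    case False
    then have "b \<in> C" "e \<in> C" using cover[OF E(1)] cover[OF E(5)] by blast+
    moreover obtain y where "y \<in> {c, d}" "y \<in> C" using cover[OF E(3)] by blast
    ultimately show ?thesis using v by (intro exI[of _ b] exI[of _ y] exI[of _ e]) auto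
  qed
  then obtain x y z where "{x, y, z} \<subseteq> C" "card {x, y, z} = 3" by auto
  moreover have "finite C"
    using assms(2) pair_finite_verts unfolding vertex_cover_def by (blast intro: finite_subset)
  ultimately show ?thesis using card_mono by metis
qed

lemma cover_cycle3_card:
  assumes "has_cycle (parcs G) 3" "vertex_cover G C"
  shows "2 \<le> card C"
proof -
  obtain a b c where v: "distinct [a, b, c]"
    and E: "(a, b) \<in> parcs G" "(b, c) \<in> parcs G" "(c, a) \<in> parcs G"
    using assms(1) by (rule has_cycle3E)
  obtain x y where "x \<noteq> y" "{x, y} \<subseteq> C"
    using v E assms(2) unfolding vertex_cover_def by (cases "a \<in> C"; cases "b \<in> C") auto
  then have "{x, y} \<subseteq> C" "card {x, y} = 2" by auto
  moreover have "finite C"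
    using assms(2) pair_finite_verts unfolding vertex_cover_def by (blast intro: finite_subset)
  ultimately show ?thesis using card_mono by metis
qed

text \<open>
  The set \<open>W\<close> induces a graph that is connected, dominated by \<open>D\<close> and not coverable with
  \<open>card D\<close> vertices.  The lower bound on covers is a hypothesis about the induced graph, so that
  the bounds for paths and cycles apply to it despite unknown extra edges.
\<close>
lemma not_perfect_if_induced:
  assumes W: "W \<subseteq> pverts G" "2 \<le> card W" "r \<in> W"
    and reach: "\<And>v. v \<in> W \<Longrightarrow> (r, v) \<in> (parcs G \<inter> W \<times> W)\<^sup>*"
    and dom: "D \<subseteq> W" "\<And>v. v \<in> W - D \<Longrightarrow> \<exists>u \<in> D. (v, u) \<in> parcs G"
    and cover: "\<And>H C. pair_graph H \<Longrightarrow> pverts H = W \<Longrightarrow> parcs H = parcs G \<inter> W \<times> W \<Longrightarrow>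
      vertex_cover H C \<Longrightarrow> card D < card C"
  shows "\<not> gamma_beta_perfect G"
proof
  assume perfect: "gamma_beta_perfect G"
  define H where "H = \<lparr>pverts = W, parcs = parcs G \<inter> W \<times> W\<rparr>"
  have H: "pverts H = W" "parcs H = parcs G \<inter> W \<times> W" unfolding H_def by simp_all
  have "pair_wf_digraph H" by unfold_locales (auto simp: H)
  then have ind: "induced_subgraph (with_proj H) (with_proj G)"
    using W(1) by (intro induced_subgraphI subgraphI)
      (auto simp: H wf_digraph_wp_iff)
  interpret H: pair_graph H by (rule induced_pair_graph[OF ind])
  have "Digraph_Component.connected (with_proj H)"
    by (rule H.connected_from_root[of r]) (simp_all add: H W(3) reach)
  then have "domination_number H = covering_number H"
    using perfect ind W(2) unfolding gamma_beta_perfect_def nontrivial_def H(1)[symmetric]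
    by blast
  moreover have "domination_number H \<le> card D"
    by (rule H.domination_number_le) (use dom in \<open>fastforce simp: dominating_set_def H\<close>)
  moreover obtain C where "vertex_cover H C" "card C = covering_number H"
    by (rule H.obtain_minimum_vertex_cover)
  ultimately show False using cover[OF H.pair_graph H] by fastforce
qed

lemma perfect_imp_no_cycle3:
  assumes "gamma_beta_perfect G"
  shows "\<not> has_cycle (parcs G) 3"
proof
  assume "has_cycle (parcs G) 3"
  then obtain a b c where v: "distinct [a, b, c]"
    and E: "(a, b) \<in> parcs G" "(b, c) \<in> parcs G" "(c, a) \<in> parcs G"
    by (rule has_cycle3E)
  let ?W = "{a, b, c}"
  have "\<not> gamma_beta_perfect G"
  proof (rule not_perfect_if_induced[of ?W a "{a}"])
    show "?W \<subseteq> pverts G" using E in_arcsD1 by blast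
    show "2 \<le> card ?W" using v by simp
    show "(a, x) \<in> (parcs G \<inter> ?W \<times> ?W)\<^sup>*" if "x \<in> ?W" for x
      using that E arcs_symmetric by blast
    show "\<exists>u\<in>{a}. (x, u) \<in> parcs G" if "x \<in> ?W - {a}" for x
      using that E arcs_symmetric by blast
    show "card {a} < card C"
      if "pair_graph H" "parcs H = parcs G \<inter> ?W \<times> ?W" "vertex_cover H C" for H C
    proof -
      have "has_cycle (parcs H) 3"
        using E that(2) pair_graph.irrefl_parcs[OF that(1)] by (intro has_cycle3I[of a b _ c]) auto
      with pair_graph.cover_cycle3_card[OF that(1) _ that(3)] show ?thesis by simp
    qed
  qed (use v in auto)
  with assms show False by simp
qed

lemma perfect_imp_no_cycle5:
  assumes "gamma_beta_perfect G"
  shows "\<not> has_cycle (parcs G) 5"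
proof
  assume "has_cycle (parcs G) 5"
  then obtain a b c d e where v: "distinct [a, b, c, d, e]"
    and E: "(a, b) \<in> parcs G" "(b, c) \<in> parcs G" "(c, d) \<in> parcs G" "(d, e) \<in> parcs G"
      "(e, a) \<in> parcs G"
    by (rule has_cycle5E)
  let ?W = "{a, b, c, d, e}"
  let ?R = "parcs G \<inter> ?W \<times> ?W"
  have "\<not> gamma_beta_perfect G"
  proof (rule not_perfect_if_induced[of ?W a "{a, c}"])
    show "?W \<subseteq> pverts G" using E in_arcsD1 by blast
    show "2 \<le> card ?W" using v by simp
    show "(a, x) \<in> ?R\<^sup>*" if "x \<in> ?W" for x
    proof -
      have b: "(a, b) \<in> ?R\<^sup>*" using E by blast
      then have c: "(a, c) \<in> ?R\<^sup>*" by (rule rtrancl_into_rtrancl) (use E in blast)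
      then have d: "(a, d) \<in> ?R\<^sup>*" by (rule rtrancl_into_rtrancl) (use E in blast)
      then have "(a, e) \<in> ?R\<^sup>*" by (rule rtrancl_into_rtrancl) (use E in blast)
      with b c d that show ?thesis by blast
    qed
    show "\<exists>u\<in>{a, c}. (x, u) \<in> parcs G" if "x \<in> ?W - {a, c}" for x
      using that E arcs_symmetric by blast
    show "card {a, c} < card C"
      if "pair_graph H" "parcs H = ?R" "vertex_cover H C" for H C
    proof -
      have "has_cycle (parcs H) 5"
        by (rule has_cycle5I[of a b c d e]) (use v E that(2) in auto)
      with pair_graph.cover_cycle5_card[OF that(1) _ that(3)] v show ?thesis by simp
    qed
  qed (use v in auto)
  with assms show False by simp
qed

lemma perfect_imp_no_path6:
  assumes "gamma_beta_perfect G"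
  shows "\<not> has_path (parcs G) 6"
proof
  assume "has_path (parcs G) 6"
  then obtain a b c d e f where v: "distinct [a, b, c, d, e, f]"
    and E: "(a, b) \<in> parcs G" "(b, c) \<in> parcs G" "(c, d) \<in> parcs G" "(d, e) \<in> parcs G"
      "(e, f) \<in> parcs G"
    by (rule has_path6E)
  let ?W = "{a, b, c, d, e, f}"
  let ?R = "parcs G \<inter> ?W \<times> ?W"
  have "\<not> gamma_beta_perfect G"
  proof (rule not_perfect_if_induced[of ?W a "{b, e}"])
    show "?W \<subseteq> pverts G" using E in_arcsD1 in_arcsD2 by blast
    show "2 \<le> card ?W" using v by simp
    show "(a, x) \<in> ?R\<^sup>*" if "x \<in> ?W" for x
    proof -
      have b: "(a, b) \<in> ?R\<^sup>*" using E by blast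
      then have c: "(a, c) \<in> ?R\<^sup>*" by (rule rtrancl_into_rtrancl) (use E in blast)
      then have d: "(a, d) \<in> ?R\<^sup>*" by (rule rtrancl_into_rtrancl) (use E in blast)
      then have e: "(a, e) \<in> ?R\<^sup>*" by (rule rtrancl_into_rtrancl) (use E in blast)
      then have "(a, f) \<in> ?R\<^sup>*" by (rule rtrancl_into_rtrancl) (use E in blast)
      with b c d e that show ?thesis by blast
    qed
    show "\<exists>u\<in>{b, e}. (x, u) \<in> parcs G" if "x \<in> ?W - {b, e}" for x
      using that E arcs_symmetric by blast
    show "card {b, e} < card C"
      if "pair_graph H" "parcs H = ?R" "vertex_cover H C" for H C
    proof -
      have "has_path (parcs H) 6"
        by (rule has_path6I[of a b c d e f]) (use v E that(2) in auto)
      with pair_graph.cover_path6_card[OF that(1) _ that(3)] v show ?thesis by simp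
    qed
  qed (use v in auto)
  with assms show False by simp
qed

lemma forbidden_free_imp_perfect:
  assumes conn: "Digraph_Component.connected (with_proj G)" and nontriv: "nontrivial G"
    and no3: "\<not> has_cycle (parcs G) 3" and no5: "\<not> has_cycle (parcs G) 5"
    and no6: "\<not> has_path (parcs G) 6"
  shows "gamma_beta_perfect G"
  unfolding gamma_beta_perfect_def
proof (intro conjI allI impI pair_graph conn nontriv, elim conjE)
  fix H :: "'a pair_pre_digraph"
  assume ind: "induced_subgraph (with_proj H) (with_proj G)"
    and H: "Digraph_Component.connected (with_proj H)" "nontrivial H"
  have "parcs H \<subseteq> parcs G" using induced_pair_graph(3)[OF ind] by blast
  then show "domination_number H = covering_number H"
    using pair_graph.domination_number_eq_covering_number[OF induced_pair_graph(1)[OF ind] H]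
      no3 no5 no6 has_cycle_mono has_path_mono by blast
qed

section \<open>Structure of graphs without the forbidden subgraphs\<close>

lemma iso_cycle5:
  assumes conn: "Digraph_Component.connected (with_proj G)"
    and no3: "\<not> has_cycle (parcs G) 3" and no6: "\<not> has_path (parcs G) 6"
    and c5: "has_cycle (parcs G) 5"
  shows "digraph_iso (with_proj G) (with_proj (cycle_graph 5))"
proof -
  obtain a b c d e where v: "distinct [a, b, c, d, e]"
    and E: "(a, b) \<in> parcs G" "(b, c) \<in> parcs G" "(c, d) \<in> parcs G" "(d, e) \<in> parcs G"
      "(e, a) \<in> parcs G"
    using c5 by (rule has_cycle5E)
  note E' = E[THEN arcs_symmetric]
  let ?Z = "{a, b, c, d, e}"
  have closed: "y \<in> ?Z" if xy: "x \<in> ?Z" "(x, y) \<in> parcs G" for x y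
  proof (rule ccontr)
    assume y: "y \<notin> ?Z"
    note yx = arcs_symmetric[OF xy(2)]
    from xy(1) consider "x = a" | "x = b" | "x = c" | "x = d" | "x = e" by blast
    then have "has_path (parcs G) 6"
    proof cases
      case 1
      show ?thesis by (rule has_path6I[of y a b c d e]) (use 1 y yx v E in auto)
    next
      case 2
      show ?thesis by (rule has_path6I[of y b c d e a]) (use 2 y yx v E in auto)
    next
      case 3
      show ?thesis by (rule has_path6I[of y c d e a b]) (use 3 y yx v E in auto)
    next
      case 4
      show ?thesis by (rule has_path6I[of y d e a b c]) (use 4 y yx v E in auto)
    next
      case 5
      show ?thesis by (rule has_path6I[of y e a b c d]) (use 5 y yx v E in auto)
    qed
    with no6 show False by simp
  qed
  have "pverts G \<subseteq> ?Z"
    by (rule connected_closed[OF conn _ in_arcsD1[OF E(1)]]) (simp, rule closed)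
  then have V: "pverts G = ?Z" using E in_arcsD1 by blast
  have chords: "(a, c) \<notin> parcs G" "(a, d) \<notin> parcs G" "(b, d) \<notin> parcs G" "(b, e) \<notin> parcs G"
    "(c, e) \<notin> parcs G"
    using E E' no3 has_cycle3I[OF _ _ _ irrefl_parcs] by blast+
  then have chords': "(c, a) \<notin> parcs G" "(d, a) \<notin> parcs G" "(d, b) \<notin> parcs G" "(e, b) \<notin> parcs G"
    "(e, c) \<notin> parcs G"
    using arcs_symmetric by blast+
  have arcs: "parcs G = {(a,b),(b,c),(c,d),(d,e),(e,a),(b,a),(c,b),(d,c),(e,d),(a,e)}" (is "_ = ?A")
  proof
    show "parcs G \<subseteq> ?A"
    proof
      fix p assume p: "p \<in> parcs G"
      obtain x y where xy: "p = (x, y)" by (cases p)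
      with p have "x \<in> ?Z" "y \<in> ?Z" "x \<noteq> y"
        using V in_arcsD1 in_arcsD2 no_loops' by blast+
      with p chords chords' show "p \<in> ?A" unfolding xy by auto
    qed
  qed (use E E' in blast)
  have verts5: "pverts (cycle_graph 5) = {0,1,2,3,4}" unfolding cycle_graph_def by auto
  have "parcs (cycle_graph 5) =
      (\<lambda>i. (i, Suc i mod 5)) ` {..<5} \<union> (\<lambda>i. (Suc i mod 5, i)) ` {..<5}"
    unfolding cycle_graph_def by auto
  also have "{..<5} = {0,1,2,3,4::nat}" by auto
  finally have arcs5: "parcs (cycle_graph 5) =
      {(0,1),(1,2),(2,3),(3,4),(4,0),(1,0),(2,1),(3,2),(4,3),(0,4)}"
    by (simp add: numeral_2_eq_2) blast
  have "digraph_iso (with_proj (cycle_graph 5)) (with_proj G)"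
    unfolding digraph_iso_pair_iff[OF wf_cycle_graph] verts5 arcs5 V arcs
    using v by (intro exI[of _ "(!) [a, b, c, d, e]"]) (simp add: nth_Cons', blast)
  then show ?thesis by (rule digraph_iso_swap[rotated]) (simp add: wf_digraph_wp_iff wf_cycle_graph)
qed

lemma iso_K2n_imp_bipartite:
  assumes "iso_connected_subgraph_K2n G n"
  obtains S where "finite S" "card S \<le> 2" "S \<subseteq> pverts G"
    "parcs G \<subseteq> S \<times> (pverts G - S) \<union> (pverts G - S) \<times> S"
proof -
  from assms obtain K H :: "nat pair_pre_digraph" where
    K: "complete_bipartite_digraph 2 n (with_proj K)"
    and HK: "subgraph (with_proj H) (with_proj K)"
    and GH: "digraph_iso (with_proj G) (with_proj H)"
    unfolding iso_connected_subgraph_K2n_def by (elim exE conjE)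
  from K obtain U W where UW: "U \<inter> W = {}" "card U = 2" "parcs K = U \<times> W \<union> W \<times> U"
    unfolding complete_bipartite_digraph_pair_def by blast
  from GH obtain f where f: "inj_on f (pverts G)" "parcs H = map_prod f f ` parcs G"
    unfolding digraph_iso_pair_iff[OF pair_wf_digraph] by blast
  have arcs: "map_prod f f ` parcs G \<subseteq> U \<times> W \<union> W \<times> U"
    using HK UW(3) f(2) unfolding subgraph_def by simp
  define S where "S = {x \<in> pverts G. f x \<in> U}"
  have "finite U" using UW(2) by (simp add: card_ge_0_finite)
  moreover have "inj_on f S" "f ` S \<subseteq> U"
    using f(1) unfolding S_def by (auto simp: inj_on_def)
  ultimately have "card S \<le> 2" using card_inj_on_le UW(2) by metis
  moreover have "parcs G \<subseteq> S \<times> (pverts G - S) \<union> (pverts G - S) \<times> S"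
  proof
    fix p assume p: "p \<in> parcs G"
    obtain x y where xy: "p = (x, y)" by (cases p)
    have "(f x, f y) \<in> U \<times> W \<union> W \<times> U" using arcs p xy by force
    then show "p \<in> S \<times> (pverts G - S) \<union> (pverts G - S) \<times> S"
      using UW(1) p in_arcsD1 in_arcsD2 unfolding xy S_def by blast
  qed
  moreover have "finite S" "S \<subseteq> pverts G" using pair_finite_verts unfolding S_def by auto
  ultimately show ?thesis using that by blast
qed

text \<open>Any injective numbering of the vertices works, since the copy of \<open>K\<^bsub>2,n\<^esub>\<close> may use arbitrary
  natural numbers as vertices; take all edges between the images of \<open>S\<close> and its complement.\<close>
lemma bipartite_imp_iso_K2n:
  assumes conn: "Digraph_Component.connected (with_proj G)"
    and S: "card S = 2" "S \<subset> pverts G"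
      "parcs G \<subseteq> S \<times> (pverts G - S) \<union> (pverts G - S) \<times> S"
  shows "\<exists>n\<ge>1. iso_connected_subgraph_K2n G n"
proof -
  obtain f :: "'a \<Rightarrow> nat" where f: "inj_on f (pverts G)"
    using finite_imp_inj_to_nat_seg[OF pair_finite_verts] by blast
  define n where "n = card (pverts G - S)"
  let ?U = "f ` S" and ?W = "f ` (pverts G - S)"
  define K where "K = \<lparr>pverts = f ` pverts G, parcs = ?U \<times> ?W \<union> ?W \<times> ?U\<rparr>"
  define H where "H = \<lparr>pverts = f ` pverts G, parcs = map_prod f f ` parcs G\<rparr>"
  have "1 \<le> n"
    unfolding n_def using S(2) pair_finite_verts by (simp add: Suc_le_eq card_gt_0_iff psubset_eq)
      (metis Diff_eq_empty_iff subset_antisym)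
  moreover have "complete_bipartite_digraph 2 n (with_proj K)"
    unfolding complete_bipartite_digraph_pair_def
  proof (intro conjI exI)
    show "finite (pverts K)" unfolding K_def using pair_finite_verts by simp
    show "pverts K = ?U \<union> ?W" unfolding K_def using S(2) by auto
    show "?U \<inter> ?W = {}" using f S(2) by (auto simp: inj_on_def)
    show "card ?U = 2" using S(1,2) card_image[OF inj_on_subset[OF f]] by auto
    show "card ?W = n" unfolding n_def using card_image[OF inj_on_subset[OF f]] by auto
  qed (simp add: K_def)
  moreover have "subgraph (with_proj H) (with_proj K)"
  proof (rule subgraphI)
    show "arcs (with_proj H) \<subseteq> arcs (with_proj K)"
      unfolding H_def K_def using S(3) by fastforce
    have "pair_wf_digraph H" "pair_wf_digraph K"
      unfolding H_def K_def using S(2) by (unfold_locales; auto dest: in_arcsD1 in_arcsD2)+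
    then show "wf_digraph (with_proj H)" "wf_digraph (with_proj K)"
      by (simp_all add: wf_digraph_wp_iff)
  qed (simp_all add: H_def K_def compatibleI_with_proj)
  moreover have iso: "digraph_iso (with_proj G) (with_proj H)"
    unfolding digraph_iso_pair_iff[OF pair_wf_digraph] H_def using f by auto
  moreover have "Digraph_Component.connected (with_proj H)"
    using iso conn connectedI_app_iso unfolding digraph_iso_def by metis
  ultimately show ?thesis unfolding iso_connected_subgraph_K2n_def by blast
qed

lemma bipartite_imp_forbidden_free:
  assumes fin: "finite S" and card: "card S \<le> 2"
    and S: "parcs G \<subseteq> S \<times> (pverts G - S) \<union> (pverts G - S) \<times> S"
  shows "\<not> has_cycle (parcs G) 3" "\<not> has_cycle (parcs G) 5" "\<not> has_path (parcs G) 6"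
proof -
  have side: "x \<in> S \<longleftrightarrow> y \<notin> S" if "(x, y) \<in> parcs G" for x y
    using that S by blast
  show "\<not> has_cycle (parcs G) 3"
    using side by (blast elim!: has_cycle3E)
  show "\<not> has_cycle (parcs G) 5"
    using side by (blast elim!: has_cycle5E)
  show "\<not> has_path (parcs G) 6"
  proof
    assume "has_path (parcs G) 6"
    moreover have "vertex_cover G (S \<inter> pverts G)"
      using S unfolding vertex_cover_def by (auto dest: in_arcsD1 in_arcsD2)
    ultimately have "3 \<le> card (S \<inter> pverts G)" by (rule cover_path6_card)
    also have "\<dots> \<le> card S" using fin by (simp add: card_mono)
    finally show False using card by simp
  qed
qed

lemma forbidden_free_imp_structure:
  assumes conn: "Digraph_Component.connected (with_proj G)"
    and no3: "\<not> has_cycle (parcs G) 3" and no5: "\<not> has_cycle (parcs G) 5"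
    and no6: "\<not> has_path (parcs G) 6"
  shows "(undirected_tree G \<and> diameter G \<le> 4) \<or> (\<exists>n\<ge>1. iso_connected_subgraph_K2n G n)"
proof (cases "has_cycle (parcs G) 4")
  case True
  then obtain S where "card S = 2" "S \<subset> pverts G"
    "parcs G \<subseteq> S \<times> (pverts G - S) \<union> (pverts G - S) \<times> S"
    using cycle4_bipartite[OF conn no3 no6] by blast
  then show ?thesis using bipartite_imp_iso_K2n[OF conn] by blast
next
  case False
  then have "undirected_tree G"
    using conn no_short_cycle_imp_acyclic no3 no5 no6 unfolding undirected_tree_iff by blast
  moreover have "diameter G \<le> 4"
    using diameter_le_iff[OF conn, of 4] no_path6_imp_short[OF conn no6] by simp
  ultimately show ?thesis by blast
qed

lemma structure_imp_forbidden_free: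
  assumes conn: "Digraph_Component.connected (with_proj G)"
    and "(undirected_tree G \<and> diameter G \<le> 4) \<or> (\<exists>n\<ge>1. iso_connected_subgraph_K2n G n)"
  shows "\<not> has_cycle (parcs G) 3 \<and> \<not> has_cycle (parcs G) 5 \<and> \<not> has_path (parcs G) 6"
  using assms(2)
proof
  assume tree: "undirected_tree G \<and> diameter G \<le> 4"
  then have "\<not> has_path (parcs G) 6"
    using diameter_le_iff[OF conn, of 4] unfolding undirected_tree_iff
    by (intro short_tree_no_path6) auto
  with tree show ?thesis unfolding undirected_tree_iff by simp
next
  assume "\<exists>n\<ge>1. iso_connected_subgraph_K2n G n"
  then show ?thesis
    using bipartite_imp_forbidden_free by (metis iso_K2n_imp_bipartite)
qed

lemma forbidden_subgraphs_iff:
  assumes conn: "Digraph_Component.connected (with_proj G)"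
  shows "\<not> digraph_iso (with_proj G) (with_proj (cycle_graph 5))
      \<and> \<not> has_subgraph_iso G (cycle_graph 3) \<and> \<not> has_subgraph_iso G (path_graph 6) \<longleftrightarrow>
    \<not> has_cycle (parcs G) 3 \<and> \<not> has_cycle (parcs G) 5 \<and> \<not> has_path (parcs G) 6"
proof -
  have "has_cycle (parcs G) 5" if "digraph_iso (with_proj G) (with_proj (cycle_graph 5))"
  proof -
    have "digraph_iso (with_proj (cycle_graph 5)) (with_proj G)"
      using wf_digraph that by (rule digraph_iso_swap)
    then have "has_subgraph_iso G (cycle_graph 5)"
      unfolding has_subgraph_iso_def using subgraph_refl by blast
    then show ?thesis by (simp add: has_subgraph_iso_cycle)
  qed
  then show ?thesis
    using iso_cycle5[OF conn] by (auto simp: has_subgraph_iso_cycle has_subgraph_iso_path)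
qed

end


section \<open>The characterisation\<close>

theorem mainTheorem1:
  fixes G :: "'a pair_pre_digraph"
  assumes "pair_graph G"
    and "nontrivial G"
    and "Digraph_Component.connected (with_proj G)"
  shows "(((undirected_tree G \<and> diameter G \<le> 4) \<or> (\<exists>n \<ge> 1. iso_connected_subgraph_K2n G n))
           \<longleftrightarrow> gamma_beta_perfect G) \<and>
         (gamma_beta_perfect G
           \<longleftrightarrow> \<not> digraph_iso (with_proj G) (with_proj (cycle_graph 5))
             \<and> \<not> has_subgraph_iso G (cycle_graph 3)
             \<and> \<not> has_subgraph_iso G (path_graph 6))"
proof -
  interpret pair_graph G by fact
  let ?free = "\<not> has_cycle (parcs G) 3 \<and> \<not> has_cycle (parcs G) 5 \<and> \<not> has_path (parcs G) 6"
  have "gamma_beta_perfect G \<longleftrightarrow> ?free"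
    using perfect_imp_no_cycle3 perfect_imp_no_cycle5 perfect_imp_no_path6
      forbidden_free_imp_perfect[OF assms(3,2)] by blast
  moreover have "((undirected_tree G \<and> diameter G \<le> 4) \<or> (\<exists>n \<ge> 1. iso_connected_subgraph_K2n G n))
      \<longleftrightarrow> ?free"
    using forbidden_free_imp_structure[OF assms(3)] structure_imp_forbidden_free[OF assms(3)]
    by blast
  ultimately show ?thesis unfolding forbidden_subgraphs_iff[OF assms(3)] by blast
qed

end
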